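(* Let $n,r$ be integers with $0\le r\le \lfloor n/2\rfloor-1$ such that the graph $G_{n,r}$ is unmixed, let $k$ be a field, and let $I=I(G_{n,r})\subseteq k[x_1,\ldots,x_n]$ be its edge ideal. Then for every integer $t\ge 1$, $D(t)$ is the set of all monomials $x_1^{a_1}x_2^{a_2}\cdots x_n^{a_n}$ such that $a_1+\cdots+a_n\le 2t-1$ and $$a_{i_1}+a_{i_2}+\cdots+a_{i_{n-(r+1)}}\ge t$$ for every tuple of $n-(r+1)$ (cyclically) consecutive indices $\{i_1,\ldots,i_{n-(r+1)}\}\subseteq\{1,\ldots,n\}$.
   Context: For integers $n,r$ with $0\le r\le \lfloor n/2\rfloor-1$, $G_{n,r}$ is the finite simple graph with vertex set $\{x_1,\ldots,x_n\}$ (in cyclic order, indices read modulo $n$, so that $x_n$ and $x_1$ are consecutive) in which each $x_i$ is adjacent to every vertex other than $x_i$ itself and the vertices of $A_i=\{x_{i-r},\ldots,x_{i-1},x_{i+1},\ldots,x_{i+r}\}$. Equivalently, for $i<j$, $x_ix_j$ is an edge iff $r+1\le j-i\le n-(r+1)$. A graph is unmixed if all its minimal (with respect to inclusion) vertex covers have the same cardinality. The edge ideal of a graph $G$ is the ideal generated by all $x_ix_j$ with $x_ix_j$ an edge of $G$. For a set of vertices $V'$ and a monomial $x^{\underline a}=x_1^{a_1}\cdots x_n^{a_n}$, the vertex weight is $W_{V'}(x^{\underline a})=\sum_{x_i\in V'}a_i$. For a graph $G$ and $t\ge1$, $D(t)=\{x^{\underline a}\mid \deg(x^{\underline a})<2t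 \text{ and } W_{V'}(x^{\underline a})\ge t \text{ for all minimal vertex covers } V' \text{ of } G\}$. *)

theory Defs
  imports "HOL-Library.Poly_Mapping" "HOL-Number_Theory.Cong" "HOL-Algebra.Ideal" Complex_Main
begin

section \<open>Graphs and vertex covers\<close>

text \<open>A finite simple graph is given by its vertex set \<open>V\<close> and a set \<open>E\<close> of two-element subsets
  of \<open>V\<close>.\<close>

definition simple_graph :: "'v set \<Rightarrow> 'v set set \<Rightarrow> bool" where
  "simple_graph V E \<longleftrightarrow> finite V \<and> (\<forall>e\<in>E. e \<subseteq> V \<and> card e = 2)"

definition vertex_cover :: "'v set \<Rightarrow> 'v set set \<Rightarrow> 'v set \<Rightarrow> bool" where
  "vertex_cover V E C \<longleftrightarrow> C \<subseteq> V \<and> (\<forall>e\<in>E. e \<inter> C \<noteq> {})"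

definition minimal_vertex_cover :: "'v set \<Rightarrow> 'v set set \<Rightarrow> 'v set \<Rightarrow> bool" where
  "minimal_vertex_cover V E C \<longleftrightarrow>
     vertex_cover V E C \<and> (\<forall>C'. C' \<subset> C \<longrightarrow> \<not> vertex_cover V E C')"

definition unmixed :: "'v set \<Rightarrow> 'v set set \<Rightarrow> bool" where
  "unmixed V E \<longleftrightarrow>
     (\<forall>C C'. minimal_vertex_cover V E C \<longrightarrow> minimal_vertex_cover V E C' \<longrightarrow> card C = card C')"

section \<open>The graphs \<open>G\<^sub>n\<^sub>,\<^sub>r\<close>\<close>

text \<open>The vertex \<open>x\<^sub>i\<close> is represented by its index \<open>i \<in> {1..n}\<close>.\<close>

definition G_verts :: "nat \<Rightarrow> nat set" where
  "G_verts n = {1..n}"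

definition G_near :: "nat \<Rightarrow> nat \<Rightarrow> nat \<Rightarrow> nat set" where
  "G_near n r i = {k \<in> G_verts n. \<exists>d\<in>{1..r}. [k = i + d] (mod n) \<or> [k + d = i] (mod n)}"

definition G_edges :: "nat \<Rightarrow> nat \<Rightarrow> nat set set" where
  "G_edges n r = {{i, j} | i j. i \<in> G_verts n \<and> j \<in> G_verts n \<and> j \<noteq> i \<and> j \<notin> G_near n r i}"

definition cyclically_consecutive :: "nat \<Rightarrow> nat list \<Rightarrow> bool" where
  "cyclically_consecutive n is \<longleftrightarrow>
     set is \<subseteq> {1..n} \<and> (\<forall>j. Suc j < length is \<longrightarrow> [is ! Suc j = is ! j + 1] (mod n))"

lemma simple_graph_G: "simple_graph (G_verts n) (G_edges n r)"
  by (auto simp: simple_graph_def G_verts_def G_edges_def card_2_iff)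

lemma G_edges_iff:
  assumes "1 \<le> i" "i < j" "j \<le> n" "int r \<le> \<lfloor>real n / 2\<rfloor> - 1"
  shows "{i, j} \<in> G_edges n r \<longleftrightarrow> r + 1 \<le> j - i \<and> j - i \<le> n - (r + 1)"
proof -
  have nearI: "b \<in> G_near n r a"
    if "b \<in> {1..n}" "d \<in> {1..r}" "[b = a + d] (mod n) \<or> [b + d = a] (mod n)" for a b d
    using that unfolding G_near_def G_verts_def by blast
  have *: "j \<in> G_near n r i \<longleftrightarrow> j - i \<le> r \<or> n - (j - i) \<le> r"
  proof
    assume "j \<in> G_near n r i"
    then obtain d where d: "1 \<le> d" "d \<le> r" "[j = i + d] (mod n) \<or> [j + d = i] (mod n)"
      by (auto simp: G_near_def)
    from d(3) show "j - i \<le> r \<or> n - (j - i) \<le> r"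
    proof
      assume "[j = i + d] (mod n)"
      then have "[int j = int i + int d] (mod int n)"
        by (metis cong_int_iff of_nat_add)
      then have "int n dvd (int j - int i) - int d"
        by (simp add: cong_iff_dvd_diff algebra_simps)
      moreover have "\<bar>(int j - int i) - int d\<bar> < int n"
        using assms d by linarith
      ultimately have "(int j - int i) - int d = 0"
        using dvd_imp_le_int[of "(int j - int i) - int d" "int n"] by linarith
      then show ?thesis using d by linarith
    next
      assume "[j + d = i] (mod n)"
      then have "[int j + int d = int i] (mod int n)"
        by (metis cong_int_iff of_nat_add)
      then have "int n dvd (int j - int i) + int d"
        by (simp add: cong_iff_dvd_diff algebra_simps)
      then have "int n \<le> (int j - int i) + int d"
        using assms d by (intro zdvd_imp_le) auto
      then show ?thesis using d assms by linarith
    qed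
  next
    assume "j - i \<le> r \<or> n - (j - i) \<le> r"
    then show "j \<in> G_near n r i"
    proof
      assume "j - i \<le> r"
      then have "j - i \<in> {1..r}" "[j = i + (j - i)] (mod n)" using assms by auto
      then show ?thesis using assms by (intro nearI[of j "j - i"]) auto
    next
      assume a: "n - (j - i) \<le> r"
      have "j + (n - (j - i)) = i + n" using assms by linarith
      then have "[j + (n - (j - i)) = i] (mod n)" by (simp add: cong_def)
      moreover have "n - (j - i) \<in> {1..r}" using a assms by auto
      ultimately show ?thesis using assms by (intro nearI[of j "n - (j - i)"]) auto
    qed
  qed
  have sym: "i \<in> G_near n r j \<longleftrightarrow> j \<in> G_near n r i"
    using assms by (auto simp: G_near_def G_verts_def intro: cong_sym)
  have "{i, j} \<in> G_edges n r \<longleftrightarrow> j \<notin> G_near n r i"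
  proof
    assume "{i, j} \<in> G_edges n r"
    then show "j \<notin> G_near n r i"
      using sym by (auto simp: G_edges_def doubleton_eq_iff)
  next
    assume "j \<notin> G_near n r i"
    moreover have "i \<in> G_verts n" "j \<in> G_verts n" "j \<noteq> i" using assms by (auto simp: G_verts_def)
    ultimately show "{i, j} \<in> G_edges n r" unfolding G_edges_def by blast
  qed
  moreover have "r + 1 \<le> n" using assms by linarith
  ultimately show ?thesis using * assms(1-3) by auto
qed

section \<open>Polynomials, edge ideals and the sets \<open>D(t)\<close>\<close>

text \<open>A polynomial is a finitely supported map from exponent vectors to coefficients. The ambient type
  has all of \<open>'v\<close> as variables; \<open>poly_ring V\<close> is the subring \<open>k[x\<^sub>v | v \<in> V]\<close>.\<close>

type_synonym ('v, 'k) mpoly = "('v \<Rightarrow>\<^sub>0 nat) \<Rightarrow>\<^sub>0 'k"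

definition monomial :: "('v \<Rightarrow>\<^sub>0 nat) \<Rightarrow> ('v, 'k::comm_ring_1) mpoly" where
  "monomial a = Poly_Mapping.single a 1"

definition var :: "'v \<Rightarrow> ('v, 'k::comm_ring_1) mpoly" where
  "var v = monomial (Poly_Mapping.single v 1)"

definition poly_ring :: "'v set \<Rightarrow> ('v, 'k::comm_ring_1) mpoly ring" where
  "poly_ring V = \<lparr>carrier = {p. \<forall>a\<in>Poly_Mapping.keys p. Poly_Mapping.keys a \<subseteq> V},
     mult = (*), one = 1, zero = 0, add = (+)\<rparr>"

lemma cring_poly_ring: "cring (poly_ring V :: ('v, 'k::comm_ring_1) mpoly ring)"
proof (rule cringI)
  show "abelian_group (poly_ring V :: ('v, 'k) mpoly ring)"
  proof (rule abelian_groupI)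
    fix x :: "('v, 'k) mpoly" assume "x \<in> carrier (poly_ring V)"
    then show "\<exists>y\<in>carrier (poly_ring V). y \<oplus>\<^bsub>poly_ring V\<^esub> x = \<zero>\<^bsub>poly_ring V\<^esub>"
      by (intro bexI[of _ "- x"]) (auto simp: poly_ring_def)
  next
    fix x y :: "('v, 'k) mpoly"
    assume "x \<in> carrier (poly_ring V)" "y \<in> carrier (poly_ring V)"
    then show "x \<oplus>\<^bsub>poly_ring V\<^esub> y \<in> carrier (poly_ring V)"
      using Poly_Mapping.keys_add[of x y] by (auto simp: poly_ring_def)
  qed (simp_all add: poly_ring_def add_ac)
  show "comm_monoid (poly_ring V :: ('v, 'k) mpoly ring)"
  proof (rule comm_monoidI)
    fix x y :: "('v, 'k) mpoly"
    assume "x \<in> carrier (poly_ring V)" "y \<in> carrier (poly_ring V)"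
    then have xy: "\<forall>a\<in>Poly_Mapping.keys x. Poly_Mapping.keys a \<subseteq> V"
      "\<forall>a\<in>Poly_Mapping.keys y. Poly_Mapping.keys a \<subseteq> V"
      by (auto simp: poly_ring_def)
    have "Poly_Mapping.keys a \<subseteq> V" if a: "a \<in> Poly_Mapping.keys (x * y)" for a
    proof -
      obtain b c where "a = b + c" "b \<in> Poly_Mapping.keys x" "c \<in> Poly_Mapping.keys y"
        using a keys_mult[of x y] by blast
      then show ?thesis using xy Poly_Mapping.keys_add[of b c] by blast
    qed
    then show "x \<otimes>\<^bsub>poly_ring V\<^esub> y \<in> carrier (poly_ring V)"
      by (simp add: poly_ring_def)
  qed (simp_all add: poly_ring_def mult_ac)
qed (simp add: poly_ring_def distrib_right)

definition edge_ideal :: "'v set \<Rightarrow> 'v set set \<Rightarrow> ('v, 'k::field) mpoly set" where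
  "edge_ideal V E = Idl\<^bsub>poly_ring V\<^esub> {var u * var v | u v. {u, v} \<in> E}"

definition mdeg :: "('v \<Rightarrow>\<^sub>0 nat) \<Rightarrow> nat" where
  "mdeg a = (\<Sum>v\<in>Poly_Mapping.keys a. Poly_Mapping.lookup a v)"

definition vertex_weight :: "'v set \<Rightarrow> ('v \<Rightarrow>\<^sub>0 nat) \<Rightarrow> nat" where
  "vertex_weight W a = (\<Sum>v\<in>W. Poly_Mapping.lookup a v)"

definition D :: "'v set \<Rightarrow> 'v set set \<Rightarrow> nat \<Rightarrow> ('v, 'k::field) mpoly set" where
  "D V E t = {monomial a | a. Poly_Mapping.keys a \<subseteq> V \<and> mdeg a < 2 * t \<and>
     (\<forall>W. minimal_vertex_cover V E W \<longrightarrow> vertex_weight W a \<ge> t)}"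

end

theory Submission
  imports Defs
begin

text \<open>
  A set is a minimal vertex cover iff it is the neighbourhood of its complement. For \<open>G\<^sub>n\<^sub>,\<^sub>r\<close>
  this shows that the arcs of \<open>n - (r + 1)\<close> consecutive vertices are minimal vertex covers. Conversely,
  let the graph be unmixed and let \<open>C\<close> be the complement of a minimal vertex cover, so that
  \<open>|C| = r + 1\<close>. Up to a shift, the cover is the sumset \<open>C + {0..m}\<close> in \<open>\<int>/n\<close>, where
  \<open>m = n - 2r - 2\<close>, and it has \<open>|C| + m\<close> elements. Adding \<open>{0, 1}\<close> to a proper nonempty subset
  always enlarges it, so if \<open>m \<ge> 1\<close> then \<open>C + {0, 1}\<close> has exactly one element more than \<open>C\<close>,
  and \<open>C\<close> is an arc. If \<open>m = 0\<close>, there are non-arc minimal covers (e.g.\ for \<open>n = 6\<close>, \<open>r = 2\<close>),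
  but then the complement of an arc of length \<open>n - (r + 1)\<close> is an arc of the same length, and the two
  weights \<open>\<ge> t\<close> contradict the bound \<open>2t - 1\<close> on the degree: both sets are empty.
\<close>

section \<open>Minimal vertex covers of an arbitrary graph\<close>

text \<open>One inclusion says that no edge joins two vertices outside \<open>W\<close>, so
  \<open>W\<close> covers. The other gives each \<open>w\<close> in \<open>W\<close> an edge whose
  second end lies outside \<open>W\<close>; such an edge is lost when \<open>w\<close> is
  dropped.\<close>

lemma minimal_vertex_cover_iff:
  assumes "simple_graph V E"
  shows "minimal_vertex_cover V E W \<longleftrightarrow> W \<subseteq> V \<and> W = {w\<in>V. \<exists>u\<in>V - W. {u, w} \<in> E}"
proof -
  have edge: "\<exists>u v. e = {u, v} \<and> u \<in> V \<and> v \<in> V \<and> u \<noteq> v" if "e \<in> E" for e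
    using assms that unfolding simple_graph_def by (metis card_2_iff insert_subset)
  show ?thesis
  proof
    assume min: "minimal_vertex_cover V E W"
    then have cov: "W \<subseteq> V" "\<And>e. e \<in> E \<Longrightarrow> e \<inter> W \<noteq> {}"
      by (auto simp: minimal_vertex_cover_def vertex_cover_def)
    have "\<exists>u\<in>V - W. {u, w} \<in> E" if w: "w \<in> W" for w
    proof -
      have "\<not> vertex_cover V E (W - {w})"
        using min w by (auto simp: minimal_vertex_cover_def)
      then obtain e where e: "e \<in> E" "e \<inter> (W - {w}) = {}"
        using cov by (auto simp: vertex_cover_def)
      with edge[OF e(1)] cov(2)[OF e(1)] w show ?thesis
        by (auto simp: insert_commute)
    qed
    with cov show "W \<subseteq> V \<and> W = {w\<in>V. \<exists>u\<in>V - W. {u, w} \<in> E}"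
      by fastforce
  next
    assume W: "W \<subseteq> V \<and> W = {w\<in>V. \<exists>u\<in>V - W. {u, w} \<in> E}"
    have "e \<inter> W \<noteq> {}" if "e \<in> E" for e
      using edge[OF that] that W by blast
    moreover have "\<not> vertex_cover V E C'" if C': "C' \<subset> W" for C'
    proof -
      obtain w where w: "w \<in> W" "w \<notin> C'" using C' by blast
      then obtain u where "u \<notin> W" "{u, w} \<in> E" using W by blast
      moreover have "{u, w} \<inter> C' = {}" using w C' \<open>u \<notin> W\<close> by blast
      ultimately show ?thesis unfolding vertex_cover_def by blast
    qed
    ultimately show "minimal_vertex_cover V E W"
      using W by (auto simp: minimal_vertex_cover_def vertex_cover_def)
  qed
qed

section \<open>Arcs of the cyclically ordered set \<open>{1..n}\<close>\<close>

text \<open>The representative of \<open>k\<close> modulo \<open>n\<close> in \<open>{1..n}\<close>,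
  for positive \<open>n\<close>. Adding \<open>n - 1\<close> plays the role of subtracting 1, which
  would be truncated at \<open>k = 0\<close>.\<close>

definition cyc :: "nat \<Rightarrow> nat \<Rightarrow> nat" where
  "cyc n k = Suc ((k + (n - 1)) mod n)"

text \<open>The run starts just after \<open>c\<close>: later \<open>c\<close> is the last vertex of
  the complementary run.\<close>

definition arc :: "nat \<Rightarrow> nat \<Rightarrow> nat \<Rightarrow> nat set" where
  "arc n c l = (\<lambda>d. cyc n (c + d)) ` {1..l}"

lemma cyc_in: "n > 0 \<Longrightarrow> cyc n k \<in> {1..n}"
  by (simp add: cyc_def Suc_leI)

lemma cyc_cong: "n > 0 \<Longrightarrow> [cyc n k = k] (mod n)"
proof -
  assume n: "n > 0"
  have "[cyc n k = Suc (k + (n - 1))] (mod n)"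
    unfolding cyc_def cong_def by (simp add: mod_Suc_eq)
  also have "Suc (k + (n - 1)) = k + n" using n by simp
  also have "[k + n = k] (mod n)" by (simp add: cong_def)
  finally show ?thesis .
qed

lemma cyc_eq_iff: "n > 0 \<Longrightarrow> cyc n a = cyc n b \<longleftrightarrow> [a = b] (mod n)"
  unfolding cyc_def nat.inject cong_def[symmetric] by (rule cong_add_rcancel_nat)

lemma cyc_id: "i \<in> {1..n} \<Longrightarrow> cyc n i = i"
proof -
  assume i: "i \<in> {1..n}"
  then have "i + (n - 1) = (i - 1) + n" by auto
  then have "(i + (n - 1)) mod n = i - 1" using i
    by (metis One_nat_def Suc_diff_1 atLeastAtMost_iff diff_Suc_less less_le_trans less_imp_diff_less
        mod_add_self2 mod_less not_less_eq_eq less_eq_Suc_le)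
  then show ?thesis unfolding cyc_def using i by simp
qed

lemma cyc_cyc_add: "n > 0 \<Longrightarrow> cyc n (cyc n a + b) = cyc n (a + b)"
  by (simp add: cyc_eq_iff cyc_cong cong_add_rcancel_nat)

lemma cyc_Suc_cyc: "n > 0 \<Longrightarrow> cyc n (Suc (cyc n a)) = cyc n (Suc a)"
  using cyc_cyc_add[of n a 1] by simp

lemma cyc_add_n: "n > 0 \<Longrightarrow> cyc n (a + n) = cyc n a"
  by (simp add: cyc_eq_iff cong_def)

lemma cyc_add_right_eq_iff: "n > 0 \<Longrightarrow> cyc n (a + d) = cyc n (b + d) \<longleftrightarrow> cyc n a = cyc n b"
  by (simp add: cyc_eq_iff cong_add_rcancel_nat)

lemma inj_on_cyc_shift: "inj_on (\<lambda>i. cyc n (i + d)) {1..n}"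
proof (rule inj_onI)
  fix x y assume xy: "x \<in> {1..n}" "y \<in> {1..n}" "cyc n (x + d) = cyc n (y + d)"
  then have "cyc n x = cyc n y" by (simp add: cyc_add_right_eq_iff)
  with xy show "x = y" by (simp add: cyc_id)
qed

lemma cyc_add_left_eq_iff:
  assumes "n > 0" "d \<in> {a<..a + n}" "e \<in> {a<..a + n}"
  shows "cyc n (c + d) = cyc n (c + e) \<longleftrightarrow> d = e"
proof
  assume "cyc n (c + d) = cyc n (c + e)"
  then have "[d = e] (mod n)" using assms(1) by (simp add: cyc_eq_iff cong_add_lcancel_nat)
  then have "int n dvd int d - int e"
    by (metis cong_iff_dvd_diff cong_int_iff)
  moreover have "\<bar>int d - int e\<bar> < int n" using assms by auto
  ultimately show "d = e" using dvd_imp_le_int[of "int d - int e" "int n"] by linarith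
qed simp

lemma inj_on_cyc: "l \<le> n \<Longrightarrow> inj_on (\<lambda>d. cyc n (c + d)) {1..l}"
  by (rule inj_onI) (use cyc_add_left_eq_iff[of n _ 0] in force)

lemma card_arc: "l \<le> n \<Longrightarrow> card (arc n c l) = l"
  unfolding arc_def by (subst card_image) (simp_all only: inj_on_cyc card_atLeastAtMost diff_Suc_1)

lemma arc_subset: "l \<le> n \<Longrightarrow> arc n c l \<subseteq> {1..n}"
  using cyc_in[of n] unfolding arc_def by fastforce

lemma arc_n: "arc n c n = {1..n}"
  by (rule card_subset_eq) (use arc_subset[of n n c] in \<open>simp_all add: card_arc\<close>)

lemma cyc_surj:
  assumes "x \<in> {1..n}"
  obtains d where "d \<in> {1..n}" "x = cyc n (c + d)"
  using assms arc_n[of n c] unfolding arc_def by (metis imageE)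

lemma arc_compl:
  assumes "l \<le> n"
  shows "{1..n} - arc n c l = (\<lambda>d. cyc n (c + d)) ` {l<..n}"
proof -
  have "{1..n} = (\<lambda>d. cyc n (c + d)) ` {1..n}" using arc_n[of n c] by (simp add: arc_def)
  also have "\<dots> - arc n c l = (\<lambda>d. cyc n (c + d)) ` ({1..n} - {1..l})"
    unfolding arc_def using assms by (intro inj_on_image_set_diff[symmetric, OF inj_on_cyc[of n n c]]) auto
  also have "{1..n} - {1..l} = {l<..n}" by auto
  finally show ?thesis .
qed

text \<open>Repeated successors of a single element run through the whole cycle. Hence a proper
  nonempty subset always has an element whose successor leaves it.\<close>

lemma cyc_succ_closed_imp_all:
  assumes "X \<subseteq> {1..n}" "X \<noteq> {}" "\<And>x. x \<in> X \<Longrightarrow> cyc n (x + 1) \<in> X"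
  shows "X = {1..n}"
proof -
  obtain c where c: "c \<in> X" "c \<in> {1..n}" using assms by blast
  have "cyc n (c + d) \<in> X" for d
  proof (induction d)
    case 0
    then show ?case using c by (simp add: cyc_id)
  next
    case (Suc d)
    then show ?case using assms(3)[OF Suc] c by (simp add: cyc_Suc_cyc)
  qed
  then show ?thesis using assms(1) by (metis cyc_surj subsetI subset_antisym)
qed

section \<open>Sumsets with an interval modulo \<open>n\<close>\<close>

text \<open>The sumset \<open>C + {0..j}\<close> modulo \<open>n\<close>, written with
  representatives in \<open>{1..n}\<close>.\<close>

definition spread :: "nat \<Rightarrow> nat set \<Rightarrow> nat \<Rightarrow> nat set" where
  "spread n C j = {cyc n (c + d) | c d. c \<in> C \<and> d \<le> j}"

lemma spread_subset: "n > 0 \<Longrightarrow> spread n C j \<subseteq> {1..n}"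
  using cyc_in unfolding spread_def by fastforce

lemma spread_mono: "i \<le> j \<Longrightarrow> spread n C i \<subseteq> spread n C j"
  unfolding spread_def using le_trans by blast

lemma spread_Suc:
  assumes "n > 0" "x \<in> spread n C j"
  shows "cyc n (x + 1) \<in> spread n C (Suc j)"
proof -
  obtain c d where "c \<in> C" "d \<le> j" "x = cyc n (c + d)" using assms by (auto simp: spread_def)
  then have "cyc n (x + 1) = cyc n (c + Suc d)" "Suc d \<le> Suc j" "c \<in> C"
    using assms(1) by (auto simp: cyc_Suc_cyc)
  then show ?thesis unfolding spread_def by blast
qed

text \<open>Each unit added to the interval contributes a new element: if two successive sumsets
  agreed, the smaller one would be closed under successors, hence everything.\<close>

lemma card_spread_ge:
  assumes "C \<subseteq> {1..n}" "C \<noteq> {}" "card (spread n C (1 + j)) < n"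
  shows "card (spread n C 1) + j \<le> card (spread n C (1 + j))"
  using assms(3)
proof (induction j)
  case (Suc j)
  let ?X = "spread n C (1 + j)" and ?Y = "spread n C (1 + Suc j)"
  have n: "n > 0" using assms by auto
  have fin: "finite ?Y" using spread_subset[OF n] by (metis finite_atLeastAtMost finite_subset)
  have sub: "?X \<subseteq> ?Y" by (rule spread_mono) simp
  have lt: "card ?X < n" using card_mono[OF fin sub] Suc.prems by linarith
  have "?X \<noteq> ?Y"
  proof
    assume eq: "?X = ?Y"
    have "?X = {1..n}"
    proof (rule cyc_succ_closed_imp_all)
      show "?X \<noteq> {}" using assms(2) by (auto simp: spread_def)
      show "cyc n (x + 1) \<in> ?X" if "x \<in> ?X" for x
        using spread_Suc[OF n that] eq by simp
    qed (rule spread_subset[OF n])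
    then show False using lt by simp
  qed
  then have "card ?X < card ?Y" using sub fin by (simp add: psubset_card_mono psubsetI)
  then show ?case using Suc.IH[OF lt] by linarith
qed simp

text \<open>Since every step from 1 to \<open>j\<close> costs at least one element, the bound at
  \<open>j\<close> descends to \<open>C + {0, 1}\<close>, which has at most one element outside
  \<open>C\<close>. So \<open>C\<close> is left at a single point \<open>c\<close>, and is one run
  ending there.\<close>

lemma compl_eq_arc_if_card_spread_le:
  assumes C: "C \<subseteq> {1..n}" "C \<noteq> {}"
    and j: "j \<ge> 1" "card (spread n C j) \<le> card C + j" "card (spread n C j) < n"
  obtains c where "c \<in> {1..n}" "{1..n} - C = arc n c (n - card C)"
proof -
  have n: "n > 0" using C by auto
  have finC: "finite C" using C finite_subset by blast
  have fin: "finite (spread n C i)" for i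
    using spread_subset[OF n] by (metis finite_atLeastAtMost finite_subset)
  have sub: "C \<subseteq> spread n C i" for i
  proof
    fix x assume x: "x \<in> C"
    then have "x = cyc n (x + 0)" using C(1) cyc_id by (metis add_0_right subsetD)
    then show "x \<in> spread n C i" using x unfolding spread_def by blast
  qed
  have lt: "card C < n" using card_mono[OF fin sub, of j] j by linarith
  have le: "card (spread n C 1) \<le> card C + 1"
    using card_spread_ge[OF C, of "j - 1"] j by simp
  have "\<exists>c\<in>C. cyc n (c + 1) \<notin> C"
    using cyc_succ_closed_imp_all[OF C] lt by fastforce
  then obtain c where c: "c \<in> C" "cyc n (c + 1) \<notin> C" by blast
  have cV: "c \<in> {1..n}" using c C by blast
  \<comment> \<open>A second exit from \<open>C\<close> would add a second new element to
    \<open>C + {0, 1}\<close>, because the shift by 1 is injective.\<close>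
  have step: "cyc n (x + 1) \<in> C" if x: "x \<in> C" "x \<noteq> c" for x
  proof (rule ccontr)
    assume notin: "cyc n (x + 1) \<notin> C"
    have ne: "cyc n (x + 1) \<noteq> cyc n (c + 1)"
      using inj_on_cyc_shift[of n 1] x c C unfolding inj_on_def by blast
    have "{cyc n (x + 1), cyc n (c + 1)} \<union> C \<subseteq> spread n C 1"
      using sub x c unfolding spread_def by blast
    then have "card ({cyc n (x + 1), cyc n (c + 1)} \<union> C) \<le> card C + 1"
      using le card_mono[OF fin] le_trans by blast
    then show False using ne notin c finC by simp
  qed
  have "arc n c (n - card C) \<subseteq> {1..n} - C"
  proof
    fix y assume y: "y \<in> arc n c (n - card C)"
    then obtain d where d: "1 \<le> d" "d \<le> n - card C" "y = cyc n (c + d)" by (auto simp: arc_def)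
    have "y \<notin> C"
    proof
      assume yC: "y \<in> C"
      \<comment> \<open>From an element of \<open>C\<close> at offset \<open>d\<close>, the walk
        stays in \<open>C\<close> up to offset \<open>n\<close>, which is \<open>c\<close> itself,
        the only exit. These \<open>n - d + 1\<close> elements are too many for
        \<open>C\<close>.\<close>
      have up: "d + k \<le> n \<Longrightarrow> cyc n (c + (d + k)) \<in> C" for k
      proof (induction k)
        case 0
        then show ?case using yC d by simp
      next
        case (Suc k)
        have "cyc n (c + (d + k)) \<noteq> cyc n (c + n)"
          using cyc_add_left_eq_iff[of n "d + k" 0 n c] n d Suc.prems by auto
        then have "cyc n (c + (d + k)) \<noteq> c" using n cV by (simp add: cyc_add_n cyc_id)
        then show ?case using step[OF Suc.IH] Suc.prems n by (simp add: cyc_Suc_cyc)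
      qed
      have "(\<lambda>e. cyc n (c + e)) ` {d..n} \<subseteq> C"
      proof clarify
        fix e assume "e \<in> {d..n}"
        then show "cyc n (c + e) \<in> C" using up[of "e - d"] by simp
      qed
      then have "card ((\<lambda>e. cyc n (c + e)) ` {d..n}) \<le> card C" by (rule card_mono[OF finC])
      moreover have "inj_on (\<lambda>e. cyc n (c + e)) {d..n}"
        using d by (intro inj_on_subset[OF inj_on_cyc[of n n c]]) auto
      ultimately have "Suc n - d \<le> card C" by (simp add: card_image)
      then show False using d lt by linarith
    qed
    then show "y \<in> {1..n} - C" using d cyc_in[OF n] by simp
  qed
  moreover have "card ({1..n} - C) = card (arc n c (n - card C))"
    using C finC by (simp add: card_Diff_subset card_arc)
  ultimately have "arc n c (n - card C) = {1..n} - C" by (intro card_subset_eq) auto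
  with cV show ?thesis by (intro that[of c]) auto
qed

section \<open>Consecutive index lists as arcs\<close>

lemma cyclically_consecutive_iff:
  assumes "l \<ge> 1" "l \<le> n"
  shows "length is = l \<and> cyclically_consecutive n is \<longleftrightarrow>
    (\<exists>c\<in>{1..n}. is = map (\<lambda>d. cyc n (c + d)) [1..<Suc l])"
proof
  assume xs: "length is = l \<and> cyclically_consecutive n is"
  have n: "n > 0" using assms by simp
  have V: "is ! j \<in> {1..n}" if "j < l" for j
    using xs that nth_mem[of j "is"] unfolding cyclically_consecutive_def by blast
  \<comment> \<open>The predecessor of the first entry, since an arc excludes its base point;
    \<open>n - 1\<close> stands for -1.\<close>
  define c where "c = cyc n (is ! 0 + (n - 1))"
  have "is ! j = cyc n (c + Suc j)" if "j < l" for j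
    using that
  proof (induction j)
    case 0
    have "cyc n (c + Suc 0) = cyc n (is ! 0 + n)"
      using n unfolding c_def by (simp add: cyc_Suc_cyc)
    then show ?case using V[OF 0] n by (simp add: cyc_add_n cyc_id)
  next
    case (Suc j)
    then have "[is ! Suc j = is ! j + 1] (mod n)"
      using xs unfolding cyclically_consecutive_def by blast
    then have "cyc n (is ! Suc j) = cyc n (is ! j + 1)" using n by (simp add: cyc_eq_iff)
    also have "\<dots> = cyc n (c + Suc (Suc j))" using Suc n by (simp add: cyc_Suc_cyc)
    finally show ?case using V[OF Suc.prems] by (simp add: cyc_id)
  qed
  then have "is = map (\<lambda>d. cyc n (c + d)) [1..<Suc l]"
    using xs by (intro nth_equalityI) (simp_all del: upt_Suc)
  moreover have "c \<in> {1..n}" using cyc_in[OF n] by (simp add: c_def)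
  ultimately show "\<exists>c\<in>{1..n}. is = map (\<lambda>d. cyc n (c + d)) [1..<Suc l]" by blast
next
  assume "\<exists>c\<in>{1..n}. is = map (\<lambda>d. cyc n (c + d)) [1..<Suc l]"
  then obtain c where xs: "is = map (\<lambda>d. cyc n (c + d)) [1..<Suc l]" by blast
  have n: "n > 0" using assms by simp
  have "[cyc n (Suc (Suc (c + j))) = Suc (cyc n (Suc (c + j)))] (mod n)" for j
    using cyc_cyc_add[OF n, of "Suc (c + j)" 1] n by (simp add: cyc_eq_iff cong_def)
      (metis cong_def cyc_cong cyc_eq_iff)
  then show "length is = l \<and> cyclically_consecutive n is"
    unfolding xs cyclically_consecutive_def using cyc_in[OF n] by (auto simp del: upt_Suc)
qed

text \<open>A list of at most \<open>n\<close> consecutive indices has no repetitions, so its list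
  sum is the sum over the arc.\<close>

lemma ball_cyclically_consecutive_iff:
  fixes f :: "nat \<Rightarrow> nat"
  assumes "l \<ge> 1" "l \<le> n"
  shows "(\<forall>is. length is = l \<and> cyclically_consecutive n is \<longrightarrow> t \<le> (\<Sum>i\<leftarrow>is. f i)) \<longleftrightarrow>
    (\<forall>c\<in>{1..n}. t \<le> (\<Sum>i\<in>arc n c l. f i))"
proof -
  have "(\<Sum>i\<leftarrow>map (\<lambda>d. cyc n (c + d)) [1..<Suc l]. f i) = (\<Sum>i\<in>arc n c l. f i)" for c
  proof -
    have "(\<Sum>i\<leftarrow>map (\<lambda>d. cyc n (c + d)) [1..<Suc l]. f i) = (\<Sum>d\<in>{1..l}. f (cyc n (c + d)))"
      by (simp add: interv_sum_list_conv_sum_set_nat o_def atLeastLessThanSuc_atLeastAtMost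
          del: upt_Suc)
    also have "\<dots> = (\<Sum>i\<in>arc n c l. f i)"
      unfolding arc_def by (simp only: sum.reindex[OF inj_on_cyc[OF assms(2)]] o_def)
    finally show ?thesis .
  qed
  then show ?thesis unfolding cyclically_consecutive_iff[OF assms] by metis
qed

section \<open>Minimal vertex covers of \<open>G\<^sub>n\<^sub>,\<^sub>r\<close>\<close>

text \<open>The admissible distances are invariant under replacing \<open>d\<close> by
  \<open>n - d\<close>, so adjacency can be read off cyclic differences without ordering
  \<open>i\<close> and \<open>j\<close>.\<close>

lemma G_edges_iff_cyc:
  assumes r: "int r \<le> \<lfloor>real n / 2\<rfloor> - 1" and ij: "i \<in> {1..n}" "j \<in> {1..n}"
  shows "{i, j} \<in> G_edges n r \<longleftrightarrow> (\<exists>d\<in>{r + 1..n - (r + 1)}. j = cyc n (i + d))"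
proof -
  have rn: "2 * r + 2 \<le> n" using r by linarith
  \<comment> \<open>The difference \<open>j - i\<close> modulo \<open>n\<close>, taken in
    \<open>{1..n}\<close>; for \<open>i = j\<close> it is \<open>n\<close>, which is no admissible
    distance.\<close>
  define e where "e = (if i < j then j - i else j + n - i)"
  have e: "e \<in> {1..n}" "cyc n (i + e) = j"
    using ij by (auto simp: e_def cyc_add_n cyc_id)
  have "j = cyc n (i + d) \<longleftrightarrow> d = e" if "d \<in> {r + 1..n - (r + 1)}" for d
    using cyc_add_left_eq_iff[of n e 0 d i] that e by auto
  then have "(\<exists>d\<in>{r + 1..n - (r + 1)}. j = cyc n (i + d)) \<longleftrightarrow> e \<in> {r + 1..n - (r + 1)}"
    by blast
  also have "\<dots> \<longleftrightarrow> {i, j} \<in> G_edges n r"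
  proof (cases i j rule: linorder_cases)
    case less
    then show ?thesis using G_edges_iff[of i j n r] r ij by (simp add: e_def)
  next
    case equal
    have "{i} \<notin> G_edges n r"
      using simple_graph_G[of n r] unfolding simple_graph_def by force
    then show ?thesis using equal rn by (simp add: e_def)
  next
    case greater
    then show ?thesis using G_edges_iff[of j i n r] r rn ij
      by (auto simp: e_def insert_commute)
  qed
  finally show ?thesis by simp
qed

lemma minimal_vertex_cover_G_iff:
  assumes r: "int r \<le> \<lfloor>real n / 2\<rfloor> - 1"
  shows "minimal_vertex_cover (G_verts n) (G_edges n r) W \<longleftrightarrow>
    W \<subseteq> {1..n} \<and> W = {cyc n (u + d) | u d. u \<in> {1..n} - W \<and> d \<in> {r + 1..n - (r + 1)}}"
proof -
  have n: "n > 0" using r by linarith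
  have "{w\<in>G_verts n. \<exists>u\<in>G_verts n - W. {u, w} \<in> G_edges n r} =
    {w\<in>{1..n}. \<exists>u\<in>{1..n} - W. \<exists>d\<in>{r + 1..n - (r + 1)}. w = cyc n (u + d)}"
    unfolding G_verts_def using G_edges_iff_cyc[OF r] by blast
  also have "\<dots> = {cyc n (u + d) | u d. u \<in> {1..n} - W \<and> d \<in> {r + 1..n - (r + 1)}}"
    using cyc_in[OF n] by blast
  finally show ?thesis
    unfolding minimal_vertex_cover_iff[OF simple_graph_G] by (simp add: G_verts_def)
qed

text \<open>In offsets from \<open>c\<close>, the complement is \<open>{n - r..n}\<close>. Adding
  the distances \<open>{r + 1..n - (r + 1)}\<close> gives \<open>{n + 1..2 * n - (r + 1)}\<close>,
  which is the arc again modulo \<open>n\<close>.\<close>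

lemma minimal_vertex_cover_arc:
  assumes r: "int r \<le> \<lfloor>real n / 2\<rfloor> - 1"
  shows "minimal_vertex_cover (G_verts n) (G_edges n r) (arc n c (n - (r + 1)))"
proof -
  let ?l = "n - (r + 1)"
  have rn: "2 * r + 2 \<le> n" using r by linarith
  then have n: "n > 0" by simp
  have "arc n c ?l = {cyc n (u + d) | u d. u \<in> {1..n} - arc n c ?l \<and> d \<in> {r + 1..?l}}"
  proof (intro subset_antisym subsetI)
    fix x assume "x \<in> arc n c ?l"
    then obtain d where d: "1 \<le> d" "d \<le> ?l" "x = cyc n (c + d)" by (auto simp: arc_def)
    \<comment> \<open>Offset of a neighbour in the complement: at distance \<open>r + 1\<close>
      behind \<open>d\<close> when that does not pass \<open>n\<close>, and otherwise at
      \<open>n\<close>, at distance \<open>d\<close>.\<close>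
    define e where "e = min n (d + n - (r + 1))"
    have e: "e \<in> {?l<..n}" "d + n - e \<in> {r + 1..?l}"
      using d rn by (auto simp: e_def min_def)
    have "cyc n (cyc n (c + e) + (d + n - e)) = cyc n (c + e + (d + n - e))"
      using n by (rule cyc_cyc_add)
    also have "c + e + (d + n - e) = c + d + n" using e by auto
    finally have "x = cyc n (cyc n (c + e) + (d + n - e))" using n d by (simp add: cyc_add_n)
    then show "x \<in> {cyc n (u + d) | u d. u \<in> {1..n} - arc n c ?l \<and> d \<in> {r + 1..?l}}"
      using e by (subst arc_compl) (simp, blast)
  next
    fix x assume "x \<in> {cyc n (u + d) | u d. u \<in> {1..n} - arc n c ?l \<and> d \<in> {r + 1..?l}}"
    then obtain u d where ud: "u \<in> {1..n} - arc n c ?l" "d \<in> {r + 1..?l}" "x = cyc n (u + d)"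
      by blast
    have "u \<in> (\<lambda>d. cyc n (c + d)) ` {?l<..n}" using ud(1) by (subst (asm) arc_compl) auto
    then obtain e where e: "e \<in> {?l<..n}" "u = cyc n (c + e)" by blast
    have "x = cyc n (c + e + d)" using ud e n by (simp add: cyc_cyc_add)
    also have "c + e + d = c + (e + d - n) + n" using e ud by auto
    also have "cyc n \<dots> = cyc n (c + (e + d - n))" using n by (rule cyc_add_n)
    finally show "x \<in> arc n c ?l" unfolding arc_def using e ud by (intro image_eqI) auto
  qed
  then show ?thesis
    unfolding minimal_vertex_cover_G_iff[OF r] using arc_subset[of ?l n c] by simp
qed

text \<open>Comparison with an arc fixes the size of \<open>W\<close> by unmixedness. As
  \<open>W\<close> is a translate of \<open>C + {0..m}\<close>, this sumset has exactly
  \<open>card C + m\<close> elements, and \<open>n \<noteq> 2 * r + 2\<close> makes \<open>m\<close>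
  positive, so the sumset bound forces an arc.\<close>

lemma minimal_vertex_cover_eq_arc:
  assumes r: "int r \<le> \<lfloor>real n / 2\<rfloor> - 1" and ne: "n \<noteq> 2 * r + 2"
    and unm: "unmixed (G_verts n) (G_edges n r)"
    and W: "minimal_vertex_cover (G_verts n) (G_edges n r) W"
  obtains c where "c \<in> {1..n}" "W = arc n c (n - (r + 1))"
proof -
  have rn: "2 * r + 3 \<le> n" using r ne by linarith
  then have n: "n > 0" by simp
  have WV: "W \<subseteq> {1..n}"
    and Weq: "W = {cyc n (u + d) | u d. u \<in> {1..n} - W \<and> d \<in> {r + 1..n - (r + 1)}}"
    using W unfolding minimal_vertex_cover_G_iff[OF r] by blast+
  have "card W = card (arc n 0 (n - (r + 1)))"
    using unm W minimal_vertex_cover_arc[OF r] unfolding unmixed_def by blast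
  then have cW: "card W = n - (r + 1)" by (simp add: card_arc)
  define C where "C = {1..n} - W"
  have cC: "card C = r + 1"
    using WV cW rn by (simp add: C_def card_Diff_subset finite_subset)
  \<comment> \<open>Chosen so that the admissible distances are \<open>r + 1\<close> plus
    \<open>{0..m}\<close>.\<close>
  define m where "m = n - (2 * r + 2)"
  have "W = (\<lambda>x. cyc n (x + (r + 1))) ` spread n C m"
  proof (intro subset_antisym subsetI)
    fix x assume "x \<in> W"
    then obtain u d where ud: "u \<in> C" "d \<in> {r + 1..n - (r + 1)}" "x = cyc n (u + d)"
      using Weq unfolding C_def by blast
    have "x = cyc n (cyc n (u + (d - (r + 1))) + (r + 1))"
      using ud n by (subst cyc_cyc_add) auto
    moreover have "cyc n (u + (d - (r + 1))) \<in> spread n C m"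
    proof -
      have "d - (r + 1) \<le> m" using ud(2) by (auto simp: m_def)
      then show ?thesis unfolding spread_def using ud(1) by blast
    qed
    ultimately show "x \<in> (\<lambda>x. cyc n (x + (r + 1))) ` spread n C m" by blast
  next
    fix x assume "x \<in> (\<lambda>x. cyc n (x + (r + 1))) ` spread n C m"
    then obtain u d where ud: "u \<in> C" "d \<le> m" "x = cyc n (cyc n (u + d) + (r + 1))"
      unfolding spread_def by blast
    then have "x = cyc n (u + (d + (r + 1)))" unfolding cyc_cyc_add[OF n] by (simp only: add.assoc)
    moreover have "d + (r + 1) \<in> {r + 1..n - (r + 1)}" using ud(2) rn by (auto simp: m_def)
    ultimately show "x \<in> W" using ud(1) Weq unfolding C_def by blast
  qed
  then have "card (spread n C m) = card W"
    using card_image[OF inj_on_subset[OF inj_on_cyc_shift spread_subset[OF n]]] by metis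
  then have cS: "card (spread n C m) = n - (r + 1)" using cW by simp
  obtain c where "c \<in> {1..n}" "{1..n} - C = arc n c (n - card C)"
  proof (rule compl_eq_arc_if_card_spread_le[of C n m])
    show "C \<noteq> {}" using cC by auto
  qed (use cS cC rn in \<open>auto simp: C_def m_def\<close>)
  moreover have "{1..n} - C = W" using WV unfolding C_def by blast
  ultimately show ?thesis using cC that by simp
qed

section \<open>Comparison of the two descriptions of \<open>D\<close>\<close>

theorem lemma4p2:
  fixes n r :: nat and I :: "(nat, 'k::field) mpoly set"
  assumes "int r \<le> \<lfloor>real n / 2\<rfloor> - 1"
    and "unmixed (G_verts n) (G_edges n r)"
    and "I = edge_ideal (G_verts n) (G_edges n r)"
  shows "\<forall>t\<ge>1. (D (G_verts n) (G_edges n r) t :: (nat, 'k) mpoly set) =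
    {monomial a | a. Poly_Mapping.keys a \<subseteq> {1..n} \<and>
       (\<Sum>i=1..n. Poly_Mapping.lookup a i) \<le> 2 * t - 1 \<and>
       (\<forall>is. length is = n - (r + 1) \<and> cyclically_consecutive n is \<longrightarrow>
          (\<Sum>i\<leftarrow>is. Poly_Mapping.lookup a i) \<ge> t)}"
proof (intro allI impI)
  fix t :: nat assume t: "t \<ge> 1"
  let ?l = "n - (r + 1)" and ?mvc = "minimal_vertex_cover (G_verts n) (G_edges n r)"
  have rn: "2 * r + 2 \<le> n" using assms(1) by linarith
  have "(Poly_Mapping.keys a \<subseteq> G_verts n \<and> mdeg a < 2 * t \<and>
      (\<forall>W. ?mvc W \<longrightarrow> t \<le> vertex_weight W a)) \<longleftrightarrow>
    (Poly_Mapping.keys a \<subseteq> {1..n} \<and> (\<Sum>i=1..n. Poly_Mapping.lookup a i) \<le> 2 * t - 1 \<and>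
      (\<forall>is. length is = ?l \<and> cyclically_consecutive n is \<longrightarrow>
        t \<le> (\<Sum>i\<leftarrow>is. Poly_Mapping.lookup a i)))" (is "?L \<longleftrightarrow> ?R") for a :: "nat \<Rightarrow>\<^sub>0 nat"
  proof (cases "Poly_Mapping.keys a \<subseteq> {1..n}")
    case True
    let ?S = "\<Sum>i=1..n. Poly_Mapping.lookup a i"
    have deg: "mdeg a = ?S"
      unfolding mdeg_def using True by (intro sum.mono_neutral_left) (auto simp: in_keys_iff)
    \<comment> \<open>The degree bound is assumed here because for \<open>n = 2 * r + 2\<close> a
      cover need not be an arc, and the implication from arcs to covers then holds by
      contradiction.\<close>
    have "(\<forall>W. ?mvc W \<longrightarrow> t \<le> vertex_weight W a) \<longleftrightarrow>
      (\<forall>c\<in>{1..n}. t \<le> vertex_weight (arc n c ?l) a)" if S: "?S < 2 * t"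
    proof (intro iffI ballI allI impI)
      fix W assume arcs: "\<forall>c\<in>{1..n}. t \<le> vertex_weight (arc n c ?l) a" and W: "?mvc W"
      show "t \<le> vertex_weight W a"
      proof (cases "n = 2 * r + 2")
        case True
        \<comment> \<open>The arcs based at \<open>n\<close> and at \<open>r + 1\<close> are the two
          halves of \<open>{1..n}\<close>. Both weights are at least \<open>t\<close>, so the degree
          is at least \<open>2 * t\<close>, contradicting \<open>S\<close>.\<close>
        then have "cyc n (n + i) = i" "cyc n (r + 1 + i) = r + 1 + i" if "i \<in> {1..r + 1}" for i
          using cyc_add_n[of n i] cyc_id[of i n] cyc_id[of "r + 1 + i" n] that
          by (simp_all add: add.commute)
        then have "arc n n ?l = (\<lambda>i. i) ` {1..r + 1}" "arc n (r + 1) ?l = (+) (r + 1) ` {1..r + 1}"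
          unfolding arc_def using True by (auto intro!: image_cong)
        then have "arc n n ?l = {1..r + 1}" "arc n (r + 1) ?l = {r + 2..n}"
          unfolding image_add_atLeastAtMost using True by (simp_all add: mult_2)
        then have "t \<le> (\<Sum>i=1..r + 1. Poly_Mapping.lookup a i)"
          "t \<le> (\<Sum>i=r + 2..n. Poly_Mapping.lookup a i)"
          using bspec[OF arcs, of n] bspec[OF arcs, of "r + 1"] True
          by (simp_all add: vertex_weight_def)
        moreover have "?S = (\<Sum>i=1..r + 1. Poly_Mapping.lookup a i) +
            (\<Sum>i=r + 2..n. Poly_Mapping.lookup a i)"
          using rn sum.ub_add_nat[of 1 "r + 1" "Poly_Mapping.lookup a" "r + 1"] True
          by (simp add: mult_2)
        ultimately show ?thesis using S by linarith
      next
        case False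
        then show ?thesis
          using minimal_vertex_cover_eq_arc[OF assms(1) False assms(2) W] arcs by metis
      qed
    qed (use minimal_vertex_cover_arc[OF assms(1)] in blast)
    \<comment> \<open>Here \<open>t \<ge> 1\<close> keeps the natural-number subtraction in
      \<open>2 * t - 1\<close> from truncating.\<close>
    moreover have "?S < 2 * t \<longleftrightarrow> ?S \<le> 2 * t - 1" using t by linarith
    ultimately show ?thesis
      using True rn by (subst ball_cyclically_consecutive_iff)
        (auto simp: deg G_verts_def vertex_weight_def)
  qed (simp add: G_verts_def)
  then show "(D (G_verts n) (G_edges n r) t :: (nat, 'k) mpoly set) =
    {monomial a | a. Poly_Mapping.keys a \<subseteq> {1..n} \<and>
       (\<Sum>i=1..n. Poly_Mapping.lookup a i) \<le> 2 * t - 1 \<and>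
       (\<forall>is. length is = ?l \<and> cyclically_consecutive n is \<longrightarrow>
          t \<le> (\<Sum>i\<leftarrow>is. Poly_Mapping.lookup a i))}"
    unfolding D_def by simp
qed

end
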